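(* Let $\mathfrak{w}$ be a weight function on $\mathbb{Z}_d\times\mathbb{Z}_d$ yielding a self-adjoint operator $\mathsf{M}^{\mathfrak{w}}$, let $f:\mathbb{Z}_d\times\mathbb{Z}_d\to\mathbb{C}$, and let $$A^{\mathfrak{w}}_f=\frac1d\sum_{(m,n)\in\mathbb{Z}_d\times\mathbb{Z}_d} f(m,n)\,\mathsf{M}^{\mathfrak{w}}(m,n).$$ Then $A^{\mathfrak{w}}_f$ is the integral operator on $L^2(\mathbb{Z}_d)$ $$(A^{\mathfrak{w}}_f\psi)(l)=\sum_{l'\in\mathbb{Z}_d}\mathcal{A}^{\mathfrak{w}}_f(l,l')\,\psi(l'),$$ and its kernel is given by $$\mathcal{A}^{\mathfrak{w}}_f(l,l')=\frac1d\sum_{m\in\mathbb{Z}_d}\mathfrak{w}(m,l-l')\,\overline{F_s}[f](m,l-l')\,e^{\mathsf{i}\frac{\pi}{d}m(l+l')},$$ where $F_s$ is the symplectic discrete Fourier transform $$F_s[f](m,n)=\frac1d\sum_{(m',n')\in\mathbb{Z}_d\times\mathbb{Z}_d}f(m',n')\,e^{-\mathsf{i}\frac{2\pi}{d}(m'n-mn')}$$ and $\overline{F_s}$ is the conjugate symplectic Fourier transform $$\overline{F_s}[f](m,n)=\frac1d\sum_{(m',n')\in\mathbb{Z}_d\times\mathbb{Z}_d}f(m',n')\,e^{\mathsf{i}\frac{2\pi}{d}(m'n-mn')}.$$ Moreover, $\overline{F_s}$ is not the inverse of $F_s$, since each is its own inverse: $F_s^2=\mathbb{1}=\overline{F_s}^2$;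 and $$\overline{F_s}F_s=F_s\overline{F_s}=\mathsf{P}_2,\qquad (\mathsf{P}_2f)(m,n)=f(-m,-n).$$
   Context: $\mathbb{Z}_d=\mathbb{Z}/d\mathbb{Z}=\{0,1,\dots,d-1\}$, the ring of integers modulo $d$. $L^2(\mathbb{Z}_d)$ is the Hilbert space of $d$-periodic complex sequences with scalar product $\langle\phi_1|\phi_2\rangle=\sum_{l\in\mathbb{Z}_d}\overline{\phi_1(l)}\phi_2(l)$. For $(m,n)\in\mathbb{Z}_d\times\mathbb{Z}_d$ the Weyl displacement operator is the unitary operator $(U(m,n)\psi)(l)=e^{-\mathsf{i}\frac{\pi}{d}mn}\,e^{\mathsf{i}\frac{2\pi}{d}ml}\,\psi(l-n)$. A weight is a (not necessarily positive) function $\mathfrak{w}$ on $\mathbb{Z}_d\times\mathbb{Z}_d$; the associated quantization operator is $\mathsf{M}^{\mathfrak{w}}=\frac1d\sum_{(m,n)\in\mathbb{Z}_d\times\mathbb{Z}_d}\mathfrak{w}(m,n)\,U(m,n)$, and $\mathfrak{w}$ is chosen so that $\mathsf{M}^{\mathfrak{w}}$ is bounded and self-adjoint. Its transport by $U$ is $\mathsf{M}^{\mathfrak{w}}(m,n)=U(m,n)\,\mathsf{M}^{\mathfrak{w}}\,U^{\dagger}(m,n)$.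
   Formalization: The kernel formula is stated for integer representatives l, l' with 0 ≤ l−l' < d (for l, l' in {0,…,d−1} with l < l' it can fail by signs (−1)^m), and "the conjugate transform is not the inverse of F_s" is stated only for d ≥ 3 (it is false for d = 1, 2). *)

theory Defs
  imports Complex_Main "Berlekamp_Zassenhaus.Finite_Field"
begin

text \<open>
  The type \<open>'d mod_ring\<close> is the ring of integers modulo \<open>d = CARD('d)\<close>, and
  \<open>to_int_mod_ring\<close> selects the representative in \<open>{0, ..., d - 1}\<close>.  A \<open>d\<close>-periodic
  sequence is a function on it, so \<open>L\<^sup>2\<close> of the integers modulo \<open>d\<close> is the full
  function space below, and its operators are functions on that type.
\<close>

type_synonym 'd phase_fun = "'d mod_ring \<times> 'd mod_ring \<Rightarrow> complex"
type_synonym 'd L2 = "'d mod_ring \<Rightarrow> complex"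
type_synonym 'd oper = "'d L2 \<Rightarrow> 'd L2"

definition scalar_prod :: "('d::finite) L2 \<Rightarrow> 'd L2 \<Rightarrow> complex" where
  "scalar_prod \<phi> \<psi> = (\<Sum>l\<in>UNIV. cnj (\<phi> l) * \<psi> l)"

definition self_adjoint :: "('d::finite) oper \<Rightarrow> bool" where
  "self_adjoint T \<longleftrightarrow> (\<forall>\<phi> \<psi>. scalar_prod (T \<phi>) \<psi> = scalar_prod \<phi> (T \<psi>))"

text \<open>Meaningful for linear \<open>T\<close>, for which such an \<open>S\<close> exists; it is always unique.\<close>

definition adj :: "('d::finite) oper \<Rightarrow> 'd oper" where
  "adj T = (THE S. \<forall>\<phi> \<psi>. scalar_prod (T \<phi>) \<psi> = scalar_prod \<phi> (S \<psi>))"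

text \<open>
  The factor \<open>exp (- \<i> \<pi> m n / d)\<close> is not periodic in \<open>m\<close> and \<open>n\<close> (replacing
  \<open>m\<close> by \<open>m + d\<close> multiplies it by \<open>(-1) ^ n\<close>); it is evaluated at the
  representatives in \<open>{0, ..., d - 1}\<close>.
\<close>

definition weyl :: "('d::finite) mod_ring \<times> 'd mod_ring \<Rightarrow> 'd oper" where
  "weyl = (\<lambda>(m, n) \<psi> l.
     exp (- \<i> * (of_real pi / of_nat CARD('d)) * of_int (to_int_mod_ring m * to_int_mod_ring n)) *
     exp (\<i> * (2 * of_real pi / of_nat CARD('d)) * of_int (to_int_mod_ring m * to_int_mod_ring l)) *
     \<psi> (l - n))"

definition quant :: "('d::finite) phase_fun \<Rightarrow> 'd oper" where
  "quant w = (\<lambda>\<psi> l. 1 / of_nat CARD('d) * (\<Sum>p\<in>UNIV. w p * weyl p \<psi> l))"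

definition quant_transport :: "('d::finite) phase_fun \<Rightarrow> 'd mod_ring \<times> 'd mod_ring \<Rightarrow> 'd oper" where
  "quant_transport w p = weyl p \<circ> quant w \<circ> adj (weyl p)"

definition quantize :: "('d::finite) phase_fun \<Rightarrow> 'd phase_fun \<Rightarrow> 'd oper" where
  "quantize w f = (\<lambda>\<psi> l. 1 / of_nat CARD('d) * (\<Sum>p\<in>UNIV. f p * quant_transport w p \<psi> l))"

definition integral_op :: "(('d::finite) mod_ring \<Rightarrow> 'd mod_ring \<Rightarrow> complex) \<Rightarrow> 'd oper" where
  "integral_op K = (\<lambda>\<psi> l. \<Sum>l'\<in>UNIV. K l l' * \<psi> l')"

definition sympl_fourier :: "('d::finite) phase_fun \<Rightarrow> 'd phase_fun" where
  "sympl_fourier f = (\<lambda>(m, n). 1 / of_nat CARD('d) * (\<Sum>(m', n')\<in>UNIV. f (m', n') *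
     exp (- \<i> * (2 * of_real pi / of_nat CARD('d)) *
       of_int (to_int_mod_ring m' * to_int_mod_ring n - to_int_mod_ring m * to_int_mod_ring n'))))"

definition conj_sympl_fourier :: "('d::finite) phase_fun \<Rightarrow> 'd phase_fun" where
  "conj_sympl_fourier f = (\<lambda>(m, n). 1 / of_nat CARD('d) * (\<Sum>(m', n')\<in>UNIV. f (m', n') *
     exp (\<i> * (2 * of_real pi / of_nat CARD('d)) *
       of_int (to_int_mod_ring m' * to_int_mod_ring n - to_int_mod_ring m * to_int_mod_ring n'))))"

definition parity2 :: "('d::finite) phase_fun \<Rightarrow> 'd phase_fun" where
  "parity2 f = (\<lambda>(m, n). f (- m, - n))"

text \<open>
  The formula for the integral kernel of \<open>quantize w f\<close>, at integers \<open>l\<close> and \<open>l'\<close>.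
  The exponential is not periodic in \<open>l\<close> and \<open>l'\<close> separately; since \<open>weyl (m, n)\<close> is
  evaluated at the representative \<open>n\<close> in \<open>{0, ..., d - 1}\<close>, the formula is valid for
  representatives with \<open>l - l'\<close> in that range.  Every pair of residue classes has
  such representatives, unique up to a simultaneous shift of \<open>l\<close> and \<open>l'\<close> by a
  multiple of \<open>d\<close>, which leaves the value unchanged.
\<close>

definition kernel_formula :: "('d::finite) phase_fun \<Rightarrow> 'd phase_fun \<Rightarrow> int \<Rightarrow> int \<Rightarrow> complex" where
  "kernel_formula w f l l' = 1 / of_nat CARD('d) * (\<Sum>m\<in>UNIV.
     w (m, of_int_mod_ring (l - l')) * conj_sympl_fourier f (m, of_int_mod_ring (l - l')) *
     exp (\<i> * (of_real pi / of_nat CARD('d)) * of_int (to_int_mod_ring m * (l + l'))))"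

end

theory Submission
  imports Defs "HOL-Analysis.Complex_Transcendental"
begin

text \<open>
  With the additive character \<open>add_char\<close> of the integers modulo \<open>d\<close>, conjugating
  \<open>U(p, q)\<close> by \<open>U(m, n)\<close> multiplies it by \<open>add_char (m q - p n)\<close>.  Averaging over
  \<open>(m, n)\<close> against \<open>f\<close> therefore turns the weight \<open>w\<close> into the product of \<open>w\<close> with
  the conjugate symplectic transform of \<open>f\<close>, and the kernel can be read off the
  displacement operators.  The two transforms differ by a reflection of the argument,
  so all composition laws follow from the involutivity of one of them, that is,
  from the orthogonality of characters.
\<close>

section \<open>Integer representatives and reindexing of sums over residues\<close>

lemma of_int_mod_ring_add:
  "(of_int_mod_ring (a + b) :: ('d::finite) mod_ring) = of_int_mod_ring a + of_int_mod_ring b"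
  by transfer (simp add: mod_simps)

lemma of_int_mod_ring_diff:
  "(of_int_mod_ring (a - b) :: ('d::finite) mod_ring) = of_int_mod_ring a - of_int_mod_ring b"
  by transfer (simp add: mod_simps)

lemma of_int_mod_ring_uminus:
  "(of_int_mod_ring (- a) :: ('d::finite) mod_ring) = - of_int_mod_ring a"
  using of_int_mod_ring_diff[of 0 a, where ?'d = 'd] by simp

lemma of_int_mod_ring_mult:
  "(of_int_mod_ring (a * b) :: ('d::finite) mod_ring) = of_int_mod_ring a * of_int_mod_ring b"
  by transfer (simp add: mod_simps)

lemma to_int_mod_ring_bounds:
  fixes x :: "('d::finite) mod_ring"
  shows "0 \<le> to_int_mod_ring x" and "to_int_mod_ring x < int CARD('d)"
  using range_to_int_mod_ring[where ?'a = 'd] by auto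

lemma to_int_mod_ring_diff_of_int:
  assumes "0 \<le> a - b" and "a - b < int CARD('d::finite)"
  shows "to_int_mod_ring (of_int_mod_ring a - of_int_mod_ring b :: 'd mod_ring) = a - b"
  using assms by (simp flip: of_int_mod_ring_diff)

lemma one_ne_uminus_one_mod_ring:
  assumes "3 \<le> CARD('d::finite)"
  shows "(of_int_mod_ring 1 :: 'd mod_ring) \<noteq> - of_int_mod_ring 1"
  using assms by transfer auto

lemma sum_UNIV_diff_right:
  fixes h :: "'a::{finite, group_add} \<Rightarrow> 'b::comm_monoid_add"
  shows "(\<Sum>x\<in>UNIV. h (x - a)) = (\<Sum>x\<in>UNIV. h x)"
  by (rule sum.reindex_bij_witness[of _ "\<lambda>x. x + a" "\<lambda>x. x - a"]) auto

lemma sum_UNIV_diff_left: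
  fixes h :: "'a::{finite, ab_group_add} \<Rightarrow> 'b::comm_monoid_add"
  shows "(\<Sum>x\<in>UNIV. h (a - x)) = (\<Sum>x\<in>UNIV. h x)"
  by (rule sum.reindex_bij_witness[of _ "\<lambda>x. a - x" "\<lambda>x. a - x"]) auto

section \<open>The additive character\<close>

definition add_char :: "('d::finite) mod_ring \<Rightarrow> complex" where
  "add_char x = exp (\<i> * (2 * of_real pi / of_nat CARD('d)) * of_int (to_int_mod_ring x))"

text \<open>Changing k by a multiple of d changes the exponent by a multiple of 2 pi i, so any
  representative may be used. This moves phase computations from integers into the ring.\<close>

lemma add_char_of_int:
  "add_char (of_int_mod_ring k :: ('d::finite) mod_ring) =
     exp (\<i> * (2 * of_real pi / of_nat CARD('d)) * of_int k)"
proof -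
  let ?d = "int CARD('d)"
  have "(of_int k :: complex) = of_int (?d * (k div ?d) + k mod ?d)"
    by simp
  also have "\<dots> = of_nat CARD('d) * of_int (k div ?d) + of_int (k mod ?d)"
    by (simp only: of_int_add of_int_mult of_int_of_nat_eq)
  finally have "\<i> * (2 * of_real pi / of_nat CARD('d)) * of_int k =
      \<i> * (2 * of_real pi / of_nat CARD('d)) * of_int (k mod ?d)
      + of_int (k div ?d) * (2 * of_real pi * \<i>)"
    by (simp add: field_simps)
  moreover have "exp (of_int (k div ?d) * (2 * of_real pi * \<i>)) = 1"
    by (subst exp_eq_1) auto
  ultimately have "exp (\<i> * (2 * of_real pi / of_nat CARD('d)) * of_int k) =
      exp (\<i> * (2 * of_real pi / of_nat CARD('d)) * of_int (k mod ?d))"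
    by (simp add: exp_add)
  moreover have "to_int_mod_ring (of_int_mod_ring k :: 'd mod_ring) = k mod ?d"
    by transfer simp
  ultimately show ?thesis
    by (simp add: add_char_def)
qed

lemma add_char_0 [simp]: "add_char 0 = 1"
  by (simp add: add_char_def)

lemma add_char_add: "add_char (x + y) = add_char x * add_char y"
proof -
  have "add_char (x + y) = add_char (of_int_mod_ring (to_int_mod_ring x + to_int_mod_ring y) :: 'a mod_ring)"
    by (simp add: of_int_mod_ring_add)
  also have "\<dots> = add_char x * add_char y"
    by (simp only: add_char_of_int) (simp only: add_char_def of_int_add distrib_left exp_add)
  finally show ?thesis .
qed

lemma add_char_uminus: "add_char (- x) = cnj (add_char x)"
proof -
  have "add_char (- x) = add_char (of_int_mod_ring (- to_int_mod_ring x) :: 'a mod_ring)"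
    by (simp add: of_int_mod_ring_uminus)
  also have "\<dots> = cnj (add_char x)"
    by (simp only: add_char_of_int) (simp add: add_char_def exp_cnj)
  finally show ?thesis .
qed

lemma add_char_eq_1_iff:
  fixes x :: "('d::finite) mod_ring"
  shows "add_char x = 1 \<longleftrightarrow> x = 0"
proof
  assume "add_char x = 1"
  then obtain k :: int
    where "2 * pi / real CARD('d) * real_of_int (to_int_mod_ring x) = of_int (2 * k) * pi"
    by (auto simp: add_char_def exp_eq_1)
  then have "real_of_int (to_int_mod_ring x) = real_of_int (k * int CARD('d))"
    by (simp add: field_simps)
  then have "to_int_mod_ring x = k * int CARD('d)"
    by linarith
  then have "to_int_mod_ring x = 0"
    using to_int_mod_ring_bounds[of x] by (simp add: zero_le_mult_iff)
  then show "x = 0"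
    by simp
qed simp

text \<open>Shifting the summation variable by the unit scales the sum by
  \<open>add_char (- a)\<close>, which differs from 1 unless a = 0; the sum must then
  vanish.\<close>

lemma sum_add_char:
  fixes a :: "('d::finite) mod_ring"
  shows "(\<Sum>x\<in>UNIV. add_char (x * a)) = (if a = 0 then of_nat CARD('d) else 0)"
proof (cases "a = 0")
  case False
  let ?S = "\<Sum>x\<in>UNIV. add_char (x * a)"
  let ?e = "of_int_mod_ring 1 :: 'd mod_ring"
  have ea: "?e * a = a"
    by (metis of_int_mod_ring_mult of_int_mod_ring_to_int_mod_ring mult_1)
  have "?S = (\<Sum>x\<in>UNIV. add_char ((x - ?e) * a))"
    by (rule sum_UNIV_diff_right[symmetric])
  also have "\<dots> = (\<Sum>x\<in>UNIV. add_char (x * a) * add_char (- a))"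
    by (simp add: left_diff_distrib ea flip: add_char_add)
  also have "\<dots> = ?S * add_char (- a)"
    by (simp add: sum_distrib_right)
  finally have "?S * (add_char (- a) - 1) = 0"
    by (simp add: algebra_simps)
  then show ?thesis
    using False by (simp add: add_char_eq_1_iff)
qed simp

section \<open>The symplectic Fourier transforms\<close>

lemma sympl_phase:
  fixes m n m' n' :: "('d::finite) mod_ring"
  shows "exp (\<i> * (2 * of_real pi / of_nat CARD('d)) *
      of_int (to_int_mod_ring m' * to_int_mod_ring n - to_int_mod_ring m * to_int_mod_ring n')) =
    add_char (m' * n - m * n')"
  by (simp only: add_char_of_int[symmetric] of_int_mod_ring_diff of_int_mod_ring_mult
      of_int_mod_ring_to_int_mod_ring)

lemma conj_sympl_fourier_eq:
  fixes f :: "('d::finite) phase_fun"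
  shows "conj_sympl_fourier f (m, n) =
    1 / of_nat CARD('d) * (\<Sum>(m', n')\<in>UNIV. f (m', n') * add_char (m' * n - m * n'))"
  by (simp only: conj_sympl_fourier_def sympl_phase prod.case)

lemma sympl_fourier_eq:
  fixes f :: "('d::finite) phase_fun"
  shows "sympl_fourier f (m, n) =
    1 / of_nat CARD('d) * (\<Sum>(m', n')\<in>UNIV. f (m', n') * add_char (m * n' - m' * n))"
proof -
  have "exp (- \<i> * (2 * of_real pi / of_nat CARD('d)) *
      of_int (to_int_mod_ring m' * to_int_mod_ring n - to_int_mod_ring m * to_int_mod_ring n')) =
    add_char (m * n' - m' * n)" for m' n' :: "'d mod_ring"
    \<comment> \<open>Exchanging the two points in \<open>sympl_phase\<close> negates the symplectic
      form, which accounts for the opposite sign.\<close>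
    unfolding sympl_phase[symmetric] by (rule arg_cong[of _ _ exp]) (simp add: field_simps)
  then show ?thesis
    by (simp only: sympl_fourier_def prod.case)
qed

lemma conj_sympl_fourier_eq_parity2: "conj_sympl_fourier f = parity2 (sympl_fourier f)"
  by (rule ext) (auto simp: conj_sympl_fourier_eq sympl_fourier_eq parity2_def)

text \<open>Reflecting the integration variable reverses the sign of the symplectic form just as
  reflecting the output point does. Hence parity commutes with the transform.\<close>

lemma conj_sympl_fourier_eq_sympl_fourier_parity2:
  fixes f :: "('d::finite) phase_fun"
  shows "conj_sympl_fourier f = sympl_fourier (parity2 f)"
proof (rule ext, clarify)
  fix m n :: "'d mod_ring"
  have "(\<Sum>(m', n')\<in>UNIV. f (- m', - n') * add_char (m * n' - m' * n)) =
      (\<Sum>(m', n')\<in>UNIV. f (m', n') * add_char (m' * n - m * n'))"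
    by (rule sum.reindex_bij_witness[of _ uminus uminus]) (auto simp: algebra_simps)
  then show "conj_sympl_fourier f (m, n) = sympl_fourier (parity2 f) (m, n)"
    by (simp add: conj_sympl_fourier_eq sympl_fourier_eq parity2_def)
qed

lemma parity2_parity2 [simp]: "parity2 (parity2 f) = f"
  by (rule ext) (auto simp: parity2_def)

text \<open>Since the symplectic form is antisymmetric, applying the same kernel twice gives phases
  that subtract: they combine to m' (b - n) + n' (m - a). The sum over (m', n') splits into two
  character sums, and the resulting d * d cancels both normalizations.\<close>

lemma sympl_fourier_sympl_fourier [simp]:
  fixes f :: "('d::finite) phase_fun"
  shows "sympl_fourier (sympl_fourier f) = f"
proof (rule ext, clarify)
  fix m n :: "'d mod_ring"
  let ?d = "of_nat CARD('d) :: complex"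
  have orth: "(\<Sum>(m', n')\<in>UNIV. add_char (m' * b - a * n') * add_char (m * n' - m' * n)) =
      (if a = m \<and> b = n then ?d * ?d else 0)" for a b
  proof -
    have "(\<Sum>(m', n')\<in>UNIV. add_char (m' * b - a * n') * add_char (m * n' - m' * n)) =
        (\<Sum>(m', n')\<in>UNIV. add_char (m' * (b - n)) * add_char (n' * (m - a)))"
      by (rule sum.cong) (auto simp: algebra_simps simp flip: add_char_add)
    also have "\<dots> = (\<Sum>m'\<in>UNIV. add_char (m' * (b - n))) * (\<Sum>n'\<in>UNIV. add_char (n' * (m - a)))"
      by (simp only: sum_product sum.cartesian_product UNIV_Times_UNIV)
    also have "\<dots> = (if a = m \<and> b = n then ?d * ?d else 0)"
      by (simp add: sum_add_char)
    finally show ?thesis .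
  qed
  have "sympl_fourier (sympl_fourier f) (m, n) =
      1 / ?d * (\<Sum>(m', n')\<in>UNIV. \<Sum>(a, b)\<in>UNIV. f (a, b) *
        (add_char (m' * b - a * n') * add_char (m * n' - m' * n)) / ?d)"
    by (simp add: sympl_fourier_eq sum_distrib_left sum_distrib_right sum_divide_distrib
        case_prod_unfold mult_ac)
  also have "\<dots> = 1 / ?d * (\<Sum>(a, b)\<in>UNIV. f (a, b) *
      (\<Sum>(m', n')\<in>UNIV. add_char (m' * b - a * n') * add_char (m * n' - m' * n)) / ?d)"
    unfolding case_prod_unfold
    by (subst sum.swap) (simp add: sum_distrib_left sum_divide_distrib)
  also have "\<dots> = (\<Sum>p\<in>UNIV. if p = (m, n) then f p else 0)"
    by (simp only: orth sum_distrib_left) (rule sum.cong, auto split: if_splits)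
  also have "\<dots> = f (m, n)"
    by simp
  finally show "sympl_fourier (sympl_fourier f) (m, n) = f (m, n)" .
qed

lemma parity2_ne_id:
  assumes "3 \<le> CARD('d::finite)"
  shows "(parity2 :: 'd phase_fun \<Rightarrow> 'd phase_fun) \<noteq> id"
proof
  let ?u = "of_int_mod_ring 1 :: 'd mod_ring"
  let ?\<delta> = "\<lambda>p :: 'd mod_ring \<times> 'd mod_ring. if p = (?u, 0) then 1 else 0 :: complex"
  assume "(parity2 :: 'd phase_fun \<Rightarrow> 'd phase_fun) = id"
  then have "parity2 ?\<delta> (?u, 0) = ?\<delta> (?u, 0)"
    by simp
  then show False
    using one_ne_uminus_one_mod_ring[OF assms] by (auto simp: parity2_def split: if_splits)
qed

section \<open>Displacement operators and their conjugates\<close>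

lemma adj_eqI:
  assumes "\<And>\<phi> \<psi>. scalar_prod (T \<phi>) \<psi> = scalar_prod \<phi> (S \<psi>)"
  shows "adj T = S"
  unfolding adj_def
proof (rule the_equality)
  fix S'
  assume S': "\<forall>\<phi> \<psi>. scalar_prod (T \<phi>) \<psi> = scalar_prod \<phi> (S' \<psi>)"
  show "S' = S"
  proof (intro ext)
    fix \<psi> and l :: "'a mod_ring"
    \<comment> \<open>Pairing with the indicator of l evaluates a sequence at l, so the adjoint
      relation determines S' pointwise.\<close>
    have delta: "scalar_prod (\<lambda>k. if k = l then 1 else 0) \<eta> = \<eta> l" for \<eta>
      by (simp add: scalar_prod_def if_distrib[of cnj] if_distrib[of "\<lambda>c. c * _"] cong: if_cong)
    show "S' \<psi> l = S \<psi> l"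
      using S' assms by (metis delta)
  qed
qed (use assms in blast)

text \<open>This half-angle factor depends on the chosen representatives, so it is kept apart from
  the character. Conjugation uses only its unimodularity; its value matters for the kernel.\<close>

definition weyl_phase :: "('d::finite) mod_ring \<Rightarrow> 'd mod_ring \<Rightarrow> complex" where
  "weyl_phase m n = exp (- \<i> * (of_real pi / of_nat CARD('d)) *
     of_int (to_int_mod_ring m * to_int_mod_ring n))"

lemma weyl_phase_mult_cnj: "weyl_phase m n * cnj (weyl_phase m n) = 1"
  by (simp add: weyl_phase_def exp_cnj flip: exp_add)

lemma weyl_eq: "weyl (m, n) \<psi> l = weyl_phase m n * add_char (m * l) * \<psi> (l - n)"
proof -
  have "add_char (m * l) = add_char (of_int_mod_ring (to_int_mod_ring m * to_int_mod_ring l) :: 'a mod_ring)"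
    by (simp add: of_int_mod_ring_mult)
  then show ?thesis
    by (simp add: weyl_def weyl_phase_def add_char_of_int)
qed

lemma adj_weyl:
  fixes m n :: "('d::finite) mod_ring"
  shows "adj (weyl (m, n)) = (\<lambda>\<psi> l. cnj (weyl_phase m n) * add_char (- (m * (l + n))) * \<psi> (l + n))"
proof (rule adj_eqI)
  fix \<phi> \<psi> :: "'d L2"
  \<comment> \<open>The argument of the second factor is left as l - n + n so that the whole summand
    is a function of l - n and the sum can be shifted.\<close>
  have "scalar_prod (weyl (m, n) \<phi>) \<psi> =
      (\<Sum>l\<in>UNIV. cnj (\<phi> (l - n)) *
        (cnj (weyl_phase m n) * add_char (- (m * (l - n + n))) * \<psi> (l - n + n)))"
    by (simp add: scalar_prod_def weyl_eq add_char_uminus mult_ac)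
  also have "\<dots> = scalar_prod \<phi> (\<lambda>l. cnj (weyl_phase m n) * add_char (- (m * (l + n))) * \<psi> (l + n))"
    unfolding scalar_prod_def by (rule sum_UNIV_diff_right)
  finally show "scalar_prod (weyl (m, n) \<phi>) \<psi> =
    scalar_prod \<phi> (\<lambda>l. cnj (weyl_phase m n) * add_char (- (m * (l + n))) * \<psi> (l + n))" .
qed

text \<open>The Weyl commutation relation. The half-angle factors of U(m, n) and its adjoint cancel
  and that of U(p, q) is carried along unchanged, so no sign ambiguity from the representatives
  arises.\<close>

lemma weyl_conjugate:
  "weyl (m, n) (weyl (p, q) (adj (weyl (m, n)) \<psi>)) l =
     add_char (m * q - p * n) * weyl (p, q) \<psi> l"
proof -
  have "weyl (m, n) (weyl (p, q) (adj (weyl (m, n)) \<psi>)) l =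
      (weyl_phase m n * cnj (weyl_phase m n)) * weyl_phase p q *
      (add_char (m * l) * add_char (p * (l - n)) * add_char (- (m * (l - n - q + n)))) *
      \<psi> (l - q)"
    by (simp only: adj_weyl) (simp add: weyl_eq mult_ac)
  also have "add_char (m * l) * add_char (p * (l - n)) * add_char (- (m * (l - n - q + n))) =
      add_char (m * q - p * n) * add_char (p * l)"
    by (simp add: algebra_simps flip: add_char_add)
  also note weyl_phase_mult_cnj
  also have "1 * weyl_phase p q * (add_char (m * q - p * n) * add_char (p * l)) * \<psi> (l - q) =
      add_char (m * q - p * n) * weyl (p, q) \<psi> l"
    by (simp add: weyl_eq mult_ac)
  finally show ?thesis .
qed

section \<open>Quantization and its integral kernel\<close>

lemma quant_transport_eq:
  fixes w :: "('d::finite) phase_fun"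
  shows "quant_transport w (m, n) \<psi> l = 1 / of_nat CARD('d) *
    (\<Sum>(p, q)\<in>UNIV. w (p, q) * (add_char (m * q - p * n) * weyl (p, q) \<psi> l))"
proof -
  have "quant_transport w (m, n) \<psi> l =
      1 / of_nat CARD('d) * (\<Sum>r\<in>UNIV. w r * weyl (m, n) (weyl r (adj (weyl (m, n)) \<psi>)) l)"
    \<comment> \<open>Unfolding the displacement by (m, n) exposes its scalar factors, which then
      pass into the sum over r.\<close>
    by (simp add: quant_transport_def weyl_eq[of m n] quant_def sum_distrib_left mult_ac)
  then show ?thesis
    by (simp add: case_prod_unfold flip: weyl_conjugate)
qed

text \<open>After exchanging the sums, the average of f(m, n) against the commutation phase
  \<open>add_char (m * q - p * n)\<close> is the conjugate transform of f at (p, q).\<close>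

lemma quantize_eq_quant:
  fixes w f :: "('d::finite) phase_fun"
  shows "quantize w f = quant (\<lambda>p. w p * conj_sympl_fourier f p)"
proof (intro ext)
  fix \<psi> l
  let ?d = "of_nat CARD('d) :: complex"
  have "quantize w f \<psi> l = 1 / ?d * (\<Sum>(m, n)\<in>UNIV. \<Sum>(p, q)\<in>UNIV.
      f (m, n) * w (p, q) * add_char (m * q - p * n) * weyl (p, q) \<psi> l / ?d)"
    by (simp add: quantize_def quant_transport_eq[of w "fst p" "snd p" for p, unfolded prod.collapse]
        case_prod_unfold sum_distrib_left sum_divide_distrib mult_ac)
  also have "\<dots> = 1 / ?d * (\<Sum>(p, q)\<in>UNIV. \<Sum>(m, n)\<in>UNIV.
      f (m, n) * w (p, q) * add_char (m * q - p * n) * weyl (p, q) \<psi> l / ?d)"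
    unfolding case_prod_unfold by (subst sum.swap) (rule refl)
  also have "\<dots> = quant (\<lambda>p. w p * conj_sympl_fourier f p) \<psi> l"
    by (simp add: quant_def conj_sympl_fourier_eq[of f "fst p" "snd p" for p, unfolded prod.collapse]
        case_prod_unfold sum_distrib_left sum_distrib_right sum_divide_distrib mult_ac)
  finally show "quantize w f \<psi> l = quant (\<lambda>p. w p * conj_sympl_fourier f p) \<psi> l" .
qed

text \<open>The substitution n = l - l' turns the sum over translations into a sum over the source
  points l'.\<close>

lemma quant_eq_integral_op:
  fixes v :: "('d::finite) phase_fun"
  shows "quant v = integral_op (\<lambda>l l'. 1 / of_nat CARD('d) *
    (\<Sum>m\<in>UNIV. v (m, l - l') * (weyl_phase m (l - l') * add_char (m * l))))"
proof (intro ext)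
  fix \<psi> :: "'d L2" and l
  let ?d = "of_nat CARD('d) :: complex"
  let ?g = "\<lambda>m n. v (m, n) * (weyl_phase m n * add_char (m * l))"
  have "quant v \<psi> l = 1 / ?d * (\<Sum>m\<in>UNIV. \<Sum>n\<in>UNIV. ?g m n * \<psi> (l - n))"
    by (simp add: quant_def weyl_eq[of "fst p" "snd p" for p, unfolded prod.collapse] sum.cartesian_product
        case_prod_unfold mult.assoc)
  also have "\<dots> = 1 / ?d * (\<Sum>n\<in>UNIV. \<Sum>m\<in>UNIV. ?g m n * \<psi> (l - n))"
    by (subst sum.swap) (rule refl)
  also have "\<dots> = 1 / ?d * (\<Sum>l'\<in>UNIV. \<Sum>m\<in>UNIV. ?g m (l - l') * \<psi> (l - (l - l')))"
    by (subst sum_UNIV_diff_left) (rule refl)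
  also have "\<dots> = integral_op (\<lambda>l l'. 1 / ?d *
      (\<Sum>m\<in>UNIV. v (m, l - l') * (weyl_phase m (l - l') * add_char (m * l)))) \<psi> l"
    by (simp add: integral_op_def sum_distrib_left sum_distrib_right sum_divide_distrib mult.assoc)
  finally show "quant v \<psi> l = integral_op (\<lambda>l l'. 1 / ?d *
      (\<Sum>m\<in>UNIV. v (m, l - l') * (weyl_phase m (l - l') * add_char (m * l)))) \<psi> l" .
qed

text \<open>The exponents add up as - m (l - l') + 2 m l = m (l + l'). The range condition makes l -
  l' the canonical representative at which \<open>weyl_phase\<close> is evaluated, while the
  character accepts any integer l.\<close>

lemma weyl_phase_mult_add_char:
  fixes m :: "('d::finite) mod_ring"
  assumes "0 \<le> l - l'" and "l - l' < int CARD('d)"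
  shows "weyl_phase m (of_int_mod_ring l - of_int_mod_ring l') * add_char (m * of_int_mod_ring l) =
    exp (\<i> * (of_real pi / of_nat CARD('d)) * of_int (to_int_mod_ring m * (l + l')))"
proof -
  have "add_char (m * of_int_mod_ring l) =
      add_char (of_int_mod_ring (to_int_mod_ring m * l) :: 'd mod_ring)"
    by (simp add: of_int_mod_ring_mult)
  then have "weyl_phase m (of_int_mod_ring l - of_int_mod_ring l') * add_char (m * of_int_mod_ring l) =
      exp (- \<i> * (of_real pi / of_nat CARD('d)) * of_int (to_int_mod_ring m * (l - l')) +
        \<i> * (2 * of_real pi / of_nat CARD('d)) * of_int (to_int_mod_ring m * l))"
    using assms by (simp only: weyl_phase_def to_int_mod_ring_diff_of_int add_char_of_int exp_add)
  also have "- \<i> * (of_real pi / of_nat CARD('d)) * of_int (to_int_mod_ring m * (l - l')) +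
      \<i> * (2 * of_real pi / of_nat CARD('d)) * of_int (to_int_mod_ring m * l) =
      \<i> * (of_real pi / of_nat CARD('d)) * of_int (to_int_mod_ring m * (l + l'))"
    by (simp add: field_simps)
  finally show ?thesis .
qed

text \<open>For d \<le> 2 every residue equals its negative, so the two transforms coincide and each
  inverts the other; hence the bound in the last claim.\<close>

theorem proposition4p9:
  fixes w f :: "('d::finite) phase_fun"
  assumes "self_adjoint (quant w)"
  shows "(\<exists>K. quantize w f = integral_op K \<and>
            (\<forall>l l'. 0 \<le> l - l' \<and> l - l' < int CARD('d) \<longrightarrow>
               K (of_int_mod_ring l) (of_int_mod_ring l') = kernel_formula w f l l')) \<and>
         (sympl_fourier :: 'd phase_fun \<Rightarrow> 'd phase_fun) \<circ> sympl_fourier = id \<and>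
         (conj_sympl_fourier :: 'd phase_fun \<Rightarrow> 'd phase_fun) \<circ> conj_sympl_fourier = id \<and>
         (conj_sympl_fourier :: 'd phase_fun \<Rightarrow> 'd phase_fun) \<circ> sympl_fourier = parity2 \<and>
         (sympl_fourier :: 'd phase_fun \<Rightarrow> 'd phase_fun) \<circ> conj_sympl_fourier = parity2 \<and>
         (3 \<le> CARD('d) \<longrightarrow>
            (conj_sympl_fourier :: 'd phase_fun \<Rightarrow> 'd phase_fun) \<noteq> inv_into UNIV sympl_fourier)"
proof (intro conjI impI)
  \<comment> \<open>The kernel of \<open>quant\<close> for the weight w times the conjugate
    transform of f, defined on all residue pairs.\<close>
  let ?K = "\<lambda>l l'. 1 / of_nat CARD('d) * (\<Sum>m\<in>UNIV.
    w (m, l - l') * conj_sympl_fourier f (m, l - l') *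
    (weyl_phase m (l - l') * add_char (m * l)))"
  show "\<exists>K. quantize w f = integral_op K \<and>
      (\<forall>l l'. 0 \<le> l - l' \<and> l - l' < int CARD('d) \<longrightarrow>
        K (of_int_mod_ring l) (of_int_mod_ring l') = kernel_formula w f l l')"
  proof (intro exI[of _ ?K] conjI allI impI)
    show "quantize w f = integral_op ?K"
      by (simp only: quantize_eq_quant quant_eq_integral_op)
  next
    fix l l'
    assume "0 \<le> l - l' \<and> l - l' < int CARD('d)"
    then show "?K (of_int_mod_ring l) (of_int_mod_ring l') = kernel_formula w f l l'"
      by (simp only: kernel_formula_def weyl_phase_mult_add_char of_int_mod_ring_diff)
  qed
  show FF: "(sympl_fourier :: 'd phase_fun \<Rightarrow> 'd phase_fun) \<circ> sympl_fourier = id"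
    by (simp add: fun_eq_iff)
  \<comment> \<open>With F the transform and P the parity, the conjugate transform is both F P and P
    F, so its square is F P P F = F F.\<close>
  show "(conj_sympl_fourier :: 'd phase_fun \<Rightarrow> 'd phase_fun) \<circ> conj_sympl_fourier = id"
    by (metis (no_types) comp_apply conj_sympl_fourier_eq_parity2
        conj_sympl_fourier_eq_sympl_fourier_parity2 eq_id_iff parity2_parity2
        sympl_fourier_sympl_fourier)
  show CF: "(conj_sympl_fourier :: 'd phase_fun \<Rightarrow> 'd phase_fun) \<circ> sympl_fourier = parity2"
    by (rule ext) (simp add: conj_sympl_fourier_eq_parity2)
  show "(sympl_fourier :: 'd phase_fun \<Rightarrow> 'd phase_fun) \<circ> conj_sympl_fourier = parity2"
    by (rule ext) (simp add: conj_sympl_fourier_eq_sympl_fourier_parity2)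
  show "(conj_sympl_fourier :: 'd phase_fun \<Rightarrow> 'd phase_fun) \<noteq> inv_into UNIV sympl_fourier"
    if "3 \<le> CARD('d)"
  proof
    assume "(conj_sympl_fourier :: 'd phase_fun \<Rightarrow> 'd phase_fun) = inv_into UNIV sympl_fourier"
    \<comment> \<open>F is an involution, hence its own inverse. Equality with the conjugate
      transform would make F F both the identity and the parity.\<close>
    also have "\<dots> = sympl_fourier"
      using FF FF by (rule inv_unique_comp)
    finally have "(parity2 :: 'd phase_fun \<Rightarrow> 'd phase_fun) = id"
      using FF CF by simp
    then show False
      using parity2_ne_id that by blast
  qed
qed

end
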